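(* Let $c \in \mathbb{R}^d$, let $k, \Delta$ be positive integers with $d \ge (k-1)\Delta + 1$, and let $s := d - ((k-1)\Delta + 1)$. Define the table $\overline{DP}[i][j]$ for integers $i \le s$ and $0 \le j \le k$ by $\overline{DP}[i][0] = 0$; $\overline{DP}[i][j] = -\infty$ if $i < 0$ (and $j \ge 1$); and otherwise $\overline{DP}[i][j] = \max\{\overline{DP}[i-1][j],\ c_{pos(i,j)} + \overline{DP}[i][j-1]\}$, where $pos(i,j) = d - (s - i) - (k - j)\Delta$. Then $\overline{DP}[s][k]$ equals the optimal value $\max_{S \in \mathbb{M}_{k,\Delta}} \sum_{i \in S} c_i$ of the $\Delta$-separated problem, and it can be computed in time $O(ks)$. The elements of an optimal set $S$ attaining this value can be output from $\overline{DP}$ in time $O(d + k)$.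
   Context: $[d] = \{1,\dots,d\}$. For $\Omega \subseteq [d]$ let $\mathrm{sep}(\Omega) = \min_{i \neq j \in \Omega}|i-j|$, and $\mathbb{M}_{k,\Delta} = \{\Omega \subseteq [d] : \mathrm{sep}(\Omega) \ge \Delta, |\Omega| = k\}$. The $\Delta$-separated problem asks for a set $S \in \mathbb{M}_{k,\Delta}$ maximizing $\sum_{i\in S} c_i$.
   Formalization: The time bound O(ks) is stated as O(k·max(1,s)): for s ≥ 1 this is the same, while for s = 0 the literal bound would be zero time, which no algorithm can meet. *)

theory Defs
  imports "HOL-Library.Extended_Real"
begin

text \<open>A vector of \<open>\<real>\<^sup>d\<close> is a function \<open>c :: nat \<Rightarrow> real\<close> of which only the entries
  \<open>c 1, \<dots>, c d\<close> are used. The separation takes values in \<open>enat\<close>, so that sets with at most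
  one element have separation \<open>\<infinity>\<close>, the minimum over the empty set.\<close>

definition sep :: "nat set \<Rightarrow> enat" where
  "sep \<Omega> = (INF (i, j) \<in> {(i, j). i \<in> \<Omega> \<and> j \<in> \<Omega> \<and> i \<noteq> j}. enat (nat \<bar>int i - int j\<bar>))"

definition sep_sets :: "nat \<Rightarrow> nat \<Rightarrow> nat \<Rightarrow> nat set set" where
  "sep_sets d k \<Delta> = {\<Omega>. \<Omega> \<subseteq> {1..d} \<and> sep \<Omega> \<ge> enat \<Delta> \<and> card \<Omega> = k}"

definition opt_value :: "nat \<Rightarrow> (nat \<Rightarrow> real) \<Rightarrow> nat \<Rightarrow> nat \<Rightarrow> real" where
  "opt_value d c k \<Delta> = Max ((\<lambda>S. \<Sum>i\<in>S. c i) ` sep_sets d k \<Delta>)"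

definition valid_params :: "nat \<Rightarrow> nat \<Rightarrow> nat \<Rightarrow> bool" where
  "valid_params d k \<Delta> \<longleftrightarrow> k > 0 \<and> \<Delta> > 0 \<and> d \<ge> (k - 1) * \<Delta> + 1"

definition slack :: "nat \<Rightarrow> nat \<Rightarrow> nat \<Rightarrow> nat" where
  "slack d k \<Delta> = d - ((k - 1) * \<Delta> + 1)"

definition pos :: "nat \<Rightarrow> nat \<Rightarrow> nat \<Rightarrow> int \<Rightarrow> nat \<Rightarrow> int" where
  "pos d k \<Delta> i j = int d - (int (slack d k \<Delta>) - i) - (int k - int j) * int \<Delta>"

function DP :: "nat \<Rightarrow> (nat \<Rightarrow> real) \<Rightarrow> nat \<Rightarrow> nat \<Rightarrow> int \<Rightarrow> nat \<Rightarrow> ereal" where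
  "DP d c k \<Delta> i j =
     (if j = 0 then 0
      else if i < 0 then -\<infinity>
      else max (DP d c k \<Delta> (i - 1) j)
               (ereal (c (nat (pos d k \<Delta> i j))) + DP d c k \<Delta> i (j - 1)))"
  by pat_completeness auto
termination
  by (relation "measure (\<lambda>(d, c, k, \<Delta>, i, j). nat (i + 1) + j)") auto

declare DP.simps [simp del]

text \<open>Running times refer to programs of a unit-cost real RAM: integer and real registers,
  one-dimensional arrays of reals with integer addresses, and a write-only output tape of
  integers. Every operation, comparison, memory access and control step costs one time unit.
  Integer multiplication is left out because at unit cost it is not a reasonable primitive on
  unbounded integers; the only real constant is \<open>0\<close>, so no data can be hidden in constants.\<close>

datatype iexp = IConst int | IReg string | IAdd iexp iexp | ISub iexp iexp

datatype rexp = RZero | RReg string | RElem string iexp | RAdd rexp rexp | RSub rexp rexp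

datatype bexp = ILess iexp iexp | RLess rexp rexp | Neg bexp | Conj bexp bexp

datatype com =
    Skip
  | ISet string iexp
  | RSet string rexp
  | Store string iexp rexp
  | Output iexp
  | Seq com com
  | If bexp com com
  | While bexp com

record state =
  ireg :: "string \<Rightarrow> int"
  rreg :: "string \<Rightarrow> real"
  arr :: "string \<Rightarrow> int \<Rightarrow> real"
  outp :: "int list"

primrec ival :: "iexp \<Rightarrow> state \<Rightarrow> int" where
  "ival (IConst n) st = n"
| "ival (IReg x) st = ireg st x"
| "ival (IAdd a b) st = ival a st + ival b st"
| "ival (ISub a b) st = ival a st - ival b st"

primrec rval :: "rexp \<Rightarrow> state \<Rightarrow> real" where
  "rval RZero st = 0"
| "rval (RReg x) st = rreg st x"
| "rval (RElem x a) st = arr st x (ival a st)"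
| "rval (RAdd r u) st = rval r st + rval u st"
| "rval (RSub r u) st = rval r st - rval u st"

primrec bval :: "bexp \<Rightarrow> state \<Rightarrow> bool" where
  "bval (ILess a b) st \<longleftrightarrow> ival a st < ival b st"
| "bval (RLess r u) st \<longleftrightarrow> rval r st < rval u st"
| "bval (Neg p) st \<longleftrightarrow> \<not> bval p st"
| "bval (Conj p q) st \<longleftrightarrow> bval p st \<and> bval q st"

primrec icost :: "iexp \<Rightarrow> nat" where
  "icost (IConst n) = 1"
| "icost (IReg x) = 1"
| "icost (IAdd a b) = 1 + icost a + icost b"
| "icost (ISub a b) = 1 + icost a + icost b"

primrec rcost :: "rexp \<Rightarrow> nat" where
  "rcost RZero = 1"
| "rcost (RReg x) = 1"
| "rcost (RElem x a) = 1 + icost a"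
| "rcost (RAdd r u) = 1 + rcost r + rcost u"
| "rcost (RSub r u) = 1 + rcost r + rcost u"

primrec bcost :: "bexp \<Rightarrow> nat" where
  "bcost (ILess a b) = 1 + icost a + icost b"
| "bcost (RLess r u) = 1 + rcost r + rcost u"
| "bcost (Neg p) = 1 + bcost p"
| "bcost (Conj p q) = 1 + bcost p + bcost q"

text \<open>\<open>exec p st t st'\<close>: started in \<open>st\<close>, the program \<open>p\<close> halts after exactly \<open>t\<close> time units
  in \<open>st'\<close>.\<close>

inductive exec :: "com \<Rightarrow> state \<Rightarrow> nat \<Rightarrow> state \<Rightarrow> bool" where
  Skip: "exec Skip st 1 st"
| ISet: "exec (ISet x a) st (1 + icost a) (st\<lparr>ireg := (ireg st)(x := ival a st)\<rparr>)"
| RSet: "exec (RSet x r) st (1 + rcost r) (st\<lparr>rreg := (rreg st)(x := rval r st)\<rparr>)"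
| Store: "exec (Store x a r) st (1 + icost a + rcost r)
     (st\<lparr>arr := (arr st)(x := (arr st x)(ival a st := rval r st))\<rparr>)"
| Output: "exec (Output a) st (1 + icost a) (st\<lparr>outp := outp st @ [ival a st]\<rparr>)"
| Seq: "exec p st t st' \<Longrightarrow> exec q st' u st'' \<Longrightarrow> exec (Seq p q) st (t + u) st''"
| IfTrue: "bval b st \<Longrightarrow> exec p st t st' \<Longrightarrow> exec (If b p q) st (1 + bcost b + t) st'"
| IfFalse: "\<not> bval b st \<Longrightarrow> exec q st t st' \<Longrightarrow> exec (If b p q) st (1 + bcost b + t) st'"
| WhileFalse: "\<not> bval b st \<Longrightarrow> exec (While b p) st (1 + bcost b) st"
| WhileTrue: "bval b st \<Longrightarrow> exec p st t st' \<Longrightarrow> exec (While b p) st' u st'' \<Longrightarrow>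
     exec (While b p) st (1 + bcost b + t + u) st''"

lemma exec_deterministic:
  "exec p st t st' \<Longrightarrow> exec p st u st'' \<Longrightarrow> t = u \<and> st' = st''"
proof (induction arbitrary: u st'' rule: exec.induct)
  case Skip
  then show ?case by (cases rule: exec.cases) simp_all
next
  case ISet
  then show ?case by (cases rule: exec.cases) simp_all
next
  case RSet
  then show ?case by (cases rule: exec.cases) simp_all
next
  case Store
  then show ?case by (cases rule: exec.cases) simp_all
next
  case Output
  then show ?case by (cases rule: exec.cases) simp_all
next
  case (Seq p st t st1 q u1 st2)
  from Seq.prems obtain t' u' s' where
    *: "exec p st t' s'" "exec q s' u' st''" "u = t' + u'"
    by (cases rule: exec.cases) simp_all
  from Seq.IH(1)[OF *(1)] Seq.IH(2) *(2,3) show ?case by simp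
next
  case (IfTrue b st p t st1 q)
  from IfTrue.prems IfTrue.hyps obtain t' where *: "exec p st t' st''" "u = 1 + bcost b + t'"
    by (cases rule: exec.cases) simp_all
  from IfTrue.IH[OF *(1)] *(2) show ?case by simp
next
  case (IfFalse b st q t st1 p)
  from IfFalse.prems IfFalse.hyps obtain t' where *: "exec q st t' st''" "u = 1 + bcost b + t'"
    by (cases rule: exec.cases) simp_all
  from IfFalse.IH[OF *(1)] *(2) show ?case by simp
next
  case (WhileFalse b st p)
  from WhileFalse.prems WhileFalse.hyps show ?case by (cases rule: exec.cases) simp_all
next
  case (WhileTrue b st p t st1 u1 st2)
  from WhileTrue.prems WhileTrue.hyps obtain t' u' s' where
    *: "exec p st t' s'" "exec (While b p) s' u' st''" "u = 1 + bcost b + t' + u'"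
    by (cases rule: exec.cases) simp_all
  from WhileTrue.IH(1)[OF *(1)] WhileTrue.IH(2) *(2,3) show ?case by simp
qed

definition holds_params :: "nat \<Rightarrow> nat \<Rightarrow> nat \<Rightarrow> state \<Rightarrow> bool" where
  "holds_params d k \<Delta> st \<longleftrightarrow>
     ireg st ''d'' = int d \<and> ireg st ''k'' = int k \<and> ireg st ''Delta'' = int \<Delta>"

definition holds_vector :: "nat \<Rightarrow> (nat \<Rightarrow> real) \<Rightarrow> state \<Rightarrow> bool" where
  "holds_vector d c st \<longleftrightarrow> (\<forall>i\<in>{1..d}. arr st ''c'' (int i) = c i)"

text \<open>The rows \<open>0, \<dots>, s\<close> of the table are stored in row-major order; the entries with a
  negative row index are constants and are not stored. All stored entries are finite.\<close>

definition holds_table :: "nat \<Rightarrow> (nat \<Rightarrow> real) \<Rightarrow> nat \<Rightarrow> nat \<Rightarrow> state \<Rightarrow> bool" where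
  "holds_table d c k \<Delta> st \<longleftrightarrow>
     (\<forall>i\<in>{0..slack d k \<Delta>}. \<forall>j\<in>{0..k}.
        ereal (arr st ''DP'' (int (i * (k + 1) + j))) = DP d c k \<Delta> (int i) j)"

end

theory Submission
  imports Defs
begin

text \<open>For \<open>j \<ge> 1\<close> the position \<open>pos i j\<close> is \<open>1 + i + (j - 1) * \<Delta>\<close>, the largest index available to
  \<open>j\<close> separated elements when \<open>i\<close> units of slack may be spent on them. An optimal set for
  \<open>(i, j)\<close> either avoids this index, and is then feasible for \<open>(i - 1, j)\<close>, or contains it, and the
  remaining \<open>j - 1\<close> elements are at distance at least \<open>\<Delta>\<close> below it, that is, feasible for
  \<open>(i, j - 1)\<close>. Walking through the table from \<open>(s, k)\<close>, a move to row \<open>i - 1\<close> is taken whenever it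
  does not lose value; hence the entries of the table suffice to recover an optimal set, in
  at most \<open>s + k\<close> steps. Table addresses and positions change by \<open>1\<close>, \<open>k + 1\<close> or \<open>\<Delta>\<close> in every step,
  so no multiplication is needed.\<close>

section \<open>Separated sets\<close>

text \<open>Ordering the two points removes the absolute value and the infimum over pairs. The
  arguments about largest elements use separation in this form.\<close>

lemma sep_ge_iff:
  "enat \<Delta> \<le> sep S \<longleftrightarrow> (\<forall>x\<in>S. \<forall>y\<in>S. x < y \<longrightarrow> x + \<Delta> \<le> y)"
proof -
  have "enat \<Delta> \<le> sep S \<longleftrightarrow> (\<forall>x\<in>S. \<forall>y\<in>S. x \<noteq> y \<longrightarrow> \<Delta> \<le> nat \<bar>int x - int y\<bar>)"
    by (auto simp: sep_def le_INF_iff)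
  also have "\<dots> \<longleftrightarrow> (\<forall>x\<in>S. \<forall>y\<in>S. x < y \<longrightarrow> x + \<Delta> \<le> y)"
  proof (intro iffI ballI impI)
    fix x y assume H: "\<forall>x\<in>S. \<forall>y\<in>S. x \<noteq> y \<longrightarrow> \<Delta> \<le> nat \<bar>int x - int y\<bar>"
      and xy: "x \<in> S" "y \<in> S" "x < y"
    have "\<Delta> \<le> nat \<bar>int x - int y\<bar>"
      using H[rule_format, of x y] xy by simp
    with xy(3) show "x + \<Delta> \<le> y" by linarith
  next
    fix x y assume H: "\<forall>x\<in>S. \<forall>y\<in>S. x < y \<longrightarrow> x + \<Delta> \<le> y"
      and xy: "x \<in> S" "y \<in> S" "x \<noteq> y"
    have "x < y \<and> x + \<Delta> \<le> y \<or> y < x \<and> y + \<Delta> \<le> x"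
      using H[rule_format, of x y] H[rule_format, of y x] xy by linarith
    then show "\<Delta> \<le> nat \<bar>int x - int y\<bar>" by linarith
  qed
  finally show ?thesis .
qed

lemma sep_sets_iff:
  "S \<in> sep_sets n k \<Delta> \<longleftrightarrow>
     S \<subseteq> {1..n} \<and> card S = k \<and> (\<forall>x\<in>S. \<forall>y\<in>S. x < y \<longrightarrow> x + \<Delta> \<le> y)"
  by (auto simp: sep_sets_def sep_ge_iff)

lemma sep_sets_mono: "S \<in> sep_sets m k \<Delta> \<Longrightarrow> m \<le> n \<Longrightarrow> S \<in> sep_sets n k \<Delta>"
  by (force simp: sep_sets_def)

lemma sep_sets_0: "sep_sets n 0 \<Delta> = {{}}"
proof -
  have "S = {}" if "S \<in> sep_sets n 0 \<Delta>" for S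
    using that finite_subset[of S "{1..n}"] by (simp add: sep_sets_iff)
  moreover have "{} \<in> sep_sets n 0 \<Delta>" by (simp add: sep_sets_iff)
  ultimately show ?thesis by blast
qed

lemma finite_sep_sets: "finite (sep_sets n k \<Delta>)"
  by (rule finite_subset[of _ "Pow {1..n}"]) (auto simp: sep_sets_def)

text \<open>Everything in \<open>S\<close> lies at least \<Delta> below \<open>p\<close>, so
  \<open>p\<close> becomes the new maximum. Truncated subtraction is harmless: for
  \<open>p \<le> \<Delta>\<close> the set \<open>S\<close> is empty.\<close>

lemma insert_sep_sets:
  assumes S: "S \<in> sep_sets (p - \<Delta>) k \<Delta>" and "0 < \<Delta>" "1 \<le> p"
  shows "insert p S \<in> sep_sets p (Suc k) \<Delta>" "p \<notin> S"
proof -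
  have below: "1 \<le> x \<and> x + \<Delta> \<le> p" if "x \<in> S" for x
    using S that by (fastforce simp: sep_sets_iff)
  then show "p \<notin> S" using \<open>0 < \<Delta>\<close> by fastforce
  moreover have "finite S"
    using S finite_subset by (auto simp: sep_sets_iff)
  moreover have "x + \<Delta> \<le> y" if "x \<in> insert p S" "y \<in> insert p S" "x < y" for x y
  proof -
    have "y \<le> p" using that(2) below[of y] by auto
    then have "x \<in> S" using that by auto
    then show ?thesis using that below[of x] S by (auto simp: sep_sets_iff)
  qed
  moreover have "insert p S \<subseteq> {1..p}" using below \<open>1 \<le> p\<close> by fastforce
  ultimately show "insert p S \<in> sep_sets p (Suc k) \<Delta>"
    using S by (auto simp: sep_sets_iff)
qed

text \<open>Separation pushes all other elements at least \<Delta> below the maximum; this reverses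
  \<open>insert_sep_sets\<close>.\<close>

lemma remove_Max_sep_sets:
  assumes S: "S \<in> sep_sets n (Suc k) \<Delta>"
  shows "S - {Max S} \<in> sep_sets (Max S - \<Delta>) k \<Delta>" "Max S \<in> S" "Max S \<le> n" "finite S"
proof -
  show fin: "finite S" using S finite_subset by (auto simp: sep_sets_iff)
  have "S \<noteq> {}" using S by (auto simp: sep_sets_iff)
  then show Max: "Max S \<in> S" using fin by simp
  then show "Max S \<le> n" using S by (auto simp: sep_sets_iff)
  have "1 \<le> x \<and> x \<le> Max S - \<Delta>" if "x \<in> S - {Max S}" for x
  proof -
    have "x \<le> Max S" using that fin by simp
    then have "x < Max S" using that by auto
    then have "x + \<Delta> \<le> Max S" using S that Max by (auto simp: sep_sets_iff)
    moreover have "1 \<le> x" using S that by (auto simp: sep_sets_iff)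
    ultimately show ?thesis by simp
  qed
  then have "S - {Max S} \<subseteq> {1..Max S - \<Delta>}" by (meson atLeastAtMost_iff subsetI)
  then show "S - {Max S} \<in> sep_sets (Max S - \<Delta>) k \<Delta>"
    using S fin Max by (auto simp: sep_sets_iff)
qed

text \<open>Removing the maximum shortens the range by \<Delta>, and the last remaining element
  still needs one index. This forces the choice when there is no slack.\<close>

lemma sep_sets_length:
  "S \<in> sep_sets n (Suc k) \<Delta> \<Longrightarrow> 1 + k * \<Delta> \<le> n"
proof (induction k arbitrary: S n)
  case 0
  then show ?case using remove_Max_sep_sets(2,3)[OF 0] by (fastforce simp: sep_sets_iff)
next
  case (Suc k)
  \<comment> \<open>The left side is positive, so the subtraction on the right is not truncated and
    \<Delta> can be added back.\<close>
  have "1 + k * \<Delta> \<le> Max S - \<Delta>" using Suc.IH remove_Max_sep_sets(1)[OF Suc.prems] .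
  then show ?case using remove_Max_sep_sets(3)[OF Suc.prems] by simp
qed


section \<open>The recurrence and its backtracking\<close>

text \<open>The table with natural row indices and real values. Row -1 is absorbed into row 0, where
  the maximum with -\<infinity> leaves only its second argument.\<close>

fun best :: "(nat \<Rightarrow> real) \<Rightarrow> nat \<Rightarrow> nat \<Rightarrow> nat \<Rightarrow> real" where
  "best c \<Delta> i 0 = 0"
| "best c \<Delta> 0 (Suc j) = c (1 + j * \<Delta>) + best c \<Delta> 0 j"
| "best c \<Delta> (Suc i) (Suc j) =
     max (best c \<Delta> i (Suc j)) (c (1 + Suc i + j * \<Delta>) + best c \<Delta> (Suc i) j)"

text \<open>In positive rows an index is taken only on a strict gain, so the decision depends on two
  table entries and never on \<open>c\<close> directly.\<close>

fun trace :: "(nat \<Rightarrow> real) \<Rightarrow> nat \<Rightarrow> nat \<Rightarrow> nat \<Rightarrow> nat list" where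
  "trace c \<Delta> i 0 = []"
| "trace c \<Delta> 0 (Suc j) = (1 + j * \<Delta>) # trace c \<Delta> 0 j"
| "trace c \<Delta> (Suc i) (Suc j) =
     (if best c \<Delta> i (Suc j) < best c \<Delta> (Suc i) (Suc j)
      then (1 + Suc i + j * \<Delta>) # trace c \<Delta> (Suc i) j
      else trace c \<Delta> i (Suc j))"

text \<open>Substituting d - s = 1 + (k - 1) \<Delta> cancels d, s and k from the position.\<close>

lemma pos_eq:
  assumes "valid_params d k \<Delta>"
  shows "pos d k \<Delta> (int i) (Suc j) = int (1 + i + j * \<Delta>)"
proof -
  obtain k' where k: "k = Suc k'" using assms by (cases k) (auto simp: valid_params_def)
  have "int (slack d k \<Delta>) = int d - (int k' * int \<Delta> + 1)"
    using assms by (simp add: valid_params_def slack_def k of_nat_diff)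
  then show ?thesis by (simp add: pos_def k algebra_simps)
qed

text \<open>Row -1 is -\<infinity> in the positive columns, so row 0 has only one option per column.
  In particular all rows from 0 on are finite and can be kept in an array of reals.\<close>

lemma DP_eq_best:
  assumes "valid_params d k \<Delta>"
  shows "DP d c k \<Delta> (int i) j = ereal (best c \<Delta> i j)"
proof (induction c \<Delta>' \<equiv> \<Delta> i j rule: best.induct)
  case (1 c i)
  show ?case by (simp add: DP.simps)
next
  case (2 c j)
  have "DP d c k \<Delta> (- 1) (Suc j) = -\<infinity>" by (simp add: DP.simps)
  then show ?case
    using 2 pos_eq[OF assms, of 0 j] by (subst DP.simps) (simp add: nat_add_distrib nat_mult_distrib)
next
  case (3 c i j)
  have "nat (pos d k \<Delta> (1 + int i) (Suc j)) = 1 + Suc i + j * \<Delta>"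
    using pos_eq[OF assms, of "Suc i" j] by (metis nat_int of_nat_Suc)
  then show ?case
    using 3 by (subst DP.simps) (simp add: ereal_max[symmetric] del: ereal_max)
qed

text \<open>The case split is on whether the maximum of \<open>S\<close> is the largest available
  index. The truncated length also serves \<open>j = 0\<close>, where the empty set is the only
  candidate whatever the length.\<close>

lemma sum_le_best:
  assumes "0 < \<Delta>"
  shows "S \<in> sep_sets (1 + i + j * \<Delta> - \<Delta>) j \<Delta> \<Longrightarrow> (\<Sum>x\<in>S. c x) \<le> best c \<Delta> i j"
proof (induction c \<Delta>' \<equiv> \<Delta> i j arbitrary: S rule: best.induct)
  case (1 c i)
  then show ?case by (simp add: sep_sets_0)
next
  case (2 c j)
  note M = remove_Max_sep_sets[OF 2(2)]
  \<comment> \<open>Without slack, \<open>j + 1\<close> separated elements need all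
    \<open>1 + j * \<Delta>\<close> indices, so the maximum must be the last one.\<close>
  have "S \<in> sep_sets (Max S) (Suc j) \<Delta>"
    using 2(2) M(4) by (auto simp: sep_sets_iff)
  then have Max: "Max S = 1 + j * \<Delta>" using sep_sets_length[of S "Max S" j \<Delta>] M(3) by simp
  have "(\<Sum>x\<in>S - {Max S}. c x) \<le> best c \<Delta> 0 j"
    using 2(1) M(1) unfolding Max by simp
  then show ?case unfolding sum.remove[OF M(4,2)] by (simp add: Max)
next
  case (3 c i j)
  note M = remove_Max_sep_sets[OF 3(3)]
  show ?case
  proof (cases "Max S = 1 + Suc i + j * \<Delta>")
    case True
    then have "(\<Sum>x\<in>S - {Max S}. c x) \<le> best c \<Delta> (Suc i) j"
      using 3(2) M(1) unfolding True by blast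
    then show ?thesis unfolding sum.remove[OF M(4,2)] by (simp add: True)
  next
    case False
    \<comment> \<open>With the last index free, \<open>S\<close> fits into a range shorter by one,
      which is the range of row \<open>i\<close>.\<close>
    then have "Max S \<le> 1 + i + j * \<Delta>" using M(3) by simp
    then have "\<forall>x\<in>S. x \<le> 1 + i + j * \<Delta>" using M(4) Max_ge le_trans by blast
    then have "S \<in> sep_sets (1 + i + Suc j * \<Delta> - \<Delta>) (Suc j) \<Delta>"
      using 3(3) by (auto simp: sep_sets_iff)
    then have "(\<Sum>x\<in>S. c x) \<le> best c \<Delta> i (Suc j)" using 3(1) by blast
    then show ?thesis by simp
  qed
qed

text \<open>Each recorded index lies at least \<Delta> above everything recorded after it, so
  \<open>insert_sep_sets\<close> rebuilds the set. This shows that the bound of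
  \<open>sum_le_best\<close> is attained.\<close>

lemma trace_correct:
  assumes "0 < \<Delta>"
  shows "set (trace c \<Delta> i j) \<in> sep_sets (1 + i + j * \<Delta> - \<Delta>) j \<Delta> \<and> distinct (trace c \<Delta> i j) \<and>
    (\<Sum>x\<in>set (trace c \<Delta> i j). c x) = best c \<Delta> i j"
proof (induction c \<Delta>' \<equiv> \<Delta> i j rule: best.induct)
  case (1 c i)
  then show ?case by (simp add: sep_sets_0)
next
  case (2 c j)
  then have "set (trace c \<Delta> 0 j) \<in> sep_sets ((1 + j * \<Delta>) - \<Delta>) j \<Delta>" by simp
  from insert_sep_sets[OF this assms] 2 show ?case by simp
next
  case (3 c i j)
  show ?case
  proof (cases "best c \<Delta> i (Suc j) < best c \<Delta> (Suc i) (Suc j)")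
    case True
    have "set (trace c \<Delta> (Suc i) j) \<in> sep_sets ((1 + Suc i + j * \<Delta>) - \<Delta>) j \<Delta>"
      using 3 by simp
    \<comment> \<open>A strict gain over the first argument of the maximum means that the second one
      is its value.\<close>
    moreover have "best c \<Delta> i (Suc j) < c (1 + Suc i + j * \<Delta>) + best c \<Delta> (Suc i) j"
      using True by (auto simp: max_def split: if_splits)
    ultimately show ?thesis
      using insert_sep_sets[OF _ assms] 3(2) by simp
  next
    case False
    then have "best c \<Delta> (Suc i) (Suc j) = best c \<Delta> i (Suc j)" by simp
    with 3(1) False show ?thesis by (auto intro: sep_sets_mono)
  qed
qed

text \<open>The first form matches the length bound of \<open>sum_le_best\<close> and
  \<open>trace_correct\<close> at \<open>(s, k)\<close>; the second suits the address and position
  computations.\<close>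

lemma slack_eq:
  assumes "valid_params d k \<Delta>"
  shows "1 + slack d k \<Delta> + k * \<Delta> - \<Delta> = d" "1 + slack d k \<Delta> + (k - 1) * \<Delta> = d"
proof -
  show *: "1 + slack d k \<Delta> + (k - 1) * \<Delta> = d"
    using assms by (simp add: valid_params_def slack_def)
  obtain k' where "k = Suc k'" using assms by (cases k) (auto simp: valid_params_def)
  with * show "1 + slack d k \<Delta> + k * \<Delta> - \<Delta> = d" by simp
qed

lemma best_eq_opt_value:
  assumes "valid_params d k \<Delta>"
  shows "best c \<Delta> (slack d k \<Delta>) k = opt_value d c k \<Delta>"
proof -
  have "0 < \<Delta>" using assms by (simp add: valid_params_def)
  note T = trace_correct[OF this, of c "slack d k \<Delta>" k, unfolded slack_eq[OF assms]]
  show ?thesis unfolding opt_value_def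
  proof (rule Max_eqI[symmetric])
    show "best c \<Delta> (slack d k \<Delta>) k \<in> (\<lambda>S. \<Sum>i\<in>S. c i) ` sep_sets d k \<Delta>"
      using T by (metis image_eqI)
    show "y \<le> best c \<Delta> (slack d k \<Delta>) k" if "y \<in> (\<lambda>S. \<Sum>i\<in>S. c i) ` sep_sets d k \<Delta>" for y
      using that sum_le_best[OF \<open>0 < \<Delta>\<close>, of _ "slack d k \<Delta>" k c] slack_eq[OF assms] by auto
  qed (simp add: finite_sep_sets)
qed

lemma holds_table_iff:
  assumes "valid_params d k \<Delta>"
  shows "holds_table d c k \<Delta> st \<longleftrightarrow>
    (\<forall>i\<le>slack d k \<Delta>. \<forall>j\<le>k. arr st ''DP'' (int (i * (k + 1) + j)) = best c \<Delta> i j)"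
  by (auto simp: holds_table_def DP_eq_best[OF assms])


section \<open>Timed total correctness\<close>

text \<open>Total correctness with an upper bound on the time instead of the exact cost. By
  \<open>exec_deterministic\<close> the run that exists is the only one.\<close>

definition runs :: "com \<Rightarrow> state \<Rightarrow> nat \<Rightarrow> (state \<Rightarrow> bool) \<Rightarrow> bool" where
  "runs p st n Q \<longleftrightarrow> (\<exists>t st'. exec p st t st' \<and> t \<le> n \<and> Q st')"

lemma runs_mono: "runs p st m Q \<Longrightarrow> (\<And>st'. Q st' \<Longrightarrow> R st') \<Longrightarrow> m \<le> n \<Longrightarrow> runs p st n R"
  unfolding runs_def by (meson le_trans)

lemma runs_Seq:
  assumes "runs p st m R" "\<And>st'. R st' \<Longrightarrow> runs q st' n Q"
  shows "runs (Seq p q) st (m + n) Q"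
proof -
  obtain t st' where 1: "exec p st t st'" "t \<le> m" "R st'"
    using assms(1) unfolding runs_def by blast
  obtain u st'' where 2: "exec q st' u st''" "u \<le> n" "Q st''"
    using assms(2)[OF 1(3)] unfolding runs_def by blast
  show ?thesis
    unfolding runs_def using exec.Seq[OF 1(1) 2(1)] 1(2) 2(2,3) by (meson add_mono)
qed

text \<open>The invariant carries an upper bound \<open>m\<close> on the number of remaining iterations.\<close>

lemma runs_While:
  assumes "I m st"
    and step: "\<And>m st. I m st \<Longrightarrow> bval b st \<Longrightarrow> 0 < m \<and> runs p st n (I (m - 1))"
  shows "runs (While b p) st ((1 + bcost b + n) * m + (1 + bcost b))
    (\<lambda>st'. \<not> bval b st' \<and> (\<exists>m. I m st'))"
  using assms(1)
proof (induction m arbitrary: st)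
  case 0
  then have "\<not> bval b st" using step by blast
  then show ?case using 0 unfolding runs_def by (auto intro!: exec.WhileFalse exI)
next
  case (Suc m)
  show ?case
  proof (cases "bval b st")
    case False
    then show ?thesis using Suc.prems unfolding runs_def by (auto intro!: exec.WhileFalse exI)
  next
    case True
    obtain t st' where 1: "exec p st t st'" "t \<le> n" "I m st'"
      using step[OF Suc.prems True] unfolding runs_def by auto
    obtain u st'' where 2: "exec (While b p) st' u st''"
      "u \<le> (1 + bcost b + n) * m + (1 + bcost b)" "\<not> bval b st''" "\<exists>m. I m st''"
      using Suc.IH[OF 1(3)] unfolding runs_def by blast
    have "1 + bcost b + t + u \<le> (1 + bcost b + n) * Suc m + (1 + bcost b)"
      using 1(2) 2(2) by simp
    then show ?thesis
      unfolding runs_def using exec.WhileTrue[OF True 1(1) 2(1)] 2(3,4) by blast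
  qed
qed

text \<open>For programs without loops the final state and a time bound are computable by recursion,
  so verifying them reduces to simplification with \<open>effect\<close> and
  \<open>worst\<close>.\<close>

primrec loop_free :: "com \<Rightarrow> bool" where
  "loop_free Skip \<longleftrightarrow> True"
| "loop_free (ISet x a) \<longleftrightarrow> True"
| "loop_free (RSet x r) \<longleftrightarrow> True"
| "loop_free (Store x a r) \<longleftrightarrow> True"
| "loop_free (Output a) \<longleftrightarrow> True"
| "loop_free (Seq p q) \<longleftrightarrow> loop_free p \<and> loop_free q"
| "loop_free (If b p q) \<longleftrightarrow> loop_free p \<and> loop_free q"
| "loop_free (While b p) \<longleftrightarrow> False"

primrec effect :: "com \<Rightarrow> state \<Rightarrow> state" where
  "effect Skip st = st"
| "effect (ISet x a) st = st\<lparr>ireg := (ireg st)(x := ival a st)\<rparr>"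
| "effect (RSet x r) st = st\<lparr>rreg := (rreg st)(x := rval r st)\<rparr>"
| "effect (Store x a r) st = st\<lparr>arr := (arr st)(x := (arr st x)(ival a st := rval r st))\<rparr>"
| "effect (Output a) st = st\<lparr>outp := outp st @ [ival a st]\<rparr>"
| "effect (Seq p q) st = effect q (effect p st)"
| "effect (If b p q) st = (if bval b st then effect p st else effect q st)"
| "effect (While b p) st = st"

text \<open>Conditionals are charged for both branches, which only enlarges constants and avoids
  maxima. The value for \<open>While\<close> is a placeholder excluded by
  \<open>loop_free\<close>.\<close>

primrec worst :: "com \<Rightarrow> nat" where
  "worst Skip = 1"
| "worst (ISet x a) = 1 + icost a"
| "worst (RSet x r) = 1 + rcost r"
| "worst (Store x a r) = 1 + icost a + rcost r"
| "worst (Output a) = 1 + icost a"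
| "worst (Seq p q) = worst p + worst q"
| "worst (If b p q) = 1 + bcost b + worst p + worst q"
| "worst (While b p) = 0"

lemma runs_loop_free:
  "loop_free p \<Longrightarrow> runs p st (worst p) (\<lambda>st'. st' = effect p st)"
proof (induction p arbitrary: st)
  case (Seq p q)
  then show ?case by (auto intro!: runs_Seq[where R = "\<lambda>st'. st' = effect p st"])
next
  case (If b p q)
  then have p: "runs p st (worst p) (\<lambda>st'. st' = effect p st)"
    and q: "runs q st (worst q) (\<lambda>st'. st' = effect q st)" by auto
  show ?case
  proof (cases "bval b st")
    case True
    then show ?thesis using p exec.IfTrue[OF True] unfolding runs_def by fastforce
  next
    case False
    then show ?thesis using q exec.IfFalse[OF False] unfolding runs_def by fastforce
  qed
qed (auto simp: runs_def intro: exec.intros[simplified])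

lemma runs_effect: "loop_free p \<Longrightarrow> Q (effect p st) \<Longrightarrow> runs p st (worst p) Q"
  by (rule runs_mono[OF runs_loop_free]) auto


section \<open>The programs\<close>

definition slack_body :: com where
  "slack_body =
     Seq (ISet ''s'' (ISub (IReg ''s'') (IReg ''Delta'')))
         (ISet ''n'' (IAdd (IReg ''n'') (IConst 1)))"

definition slack_com :: com where
  "slack_com =
     Seq (Seq (ISet ''s'' (ISub (IReg ''d'') (IConst 1))) (ISet ''n'' (IConst 1)))
         (While (ILess (IReg ''n'') (IReg ''k'')) slack_body)"

lemma runs_slack_com:
  assumes v: "valid_params d k \<Delta>" and h: "holds_params d k \<Delta> st"
  shows "runs slack_com st (20 * k) (\<lambda>st'. holds_params d k \<Delta> st' \<and>
    ireg st' ''s'' = int (slack d k \<Delta>) \<and> arr st' = arr st \<and> outp st' = outp st)"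
proof -
  \<comment> \<open>After \<open>n\<close> rounds the register \<open>n\<close> holds
    \<open>n + 1\<close>, because counting starts at 1; \<open>m\<close> rounds remain out of
    \<open>k - 1\<close>.\<close>
  define I where "I m st' \<longleftrightarrow> holds_params d k \<Delta> st' \<and> arr st' = arr st \<and> outp st' = outp st \<and>
      (\<exists>n. k = n + m + 1 \<and> ireg st' ''n'' = int n + 1 \<and>
         ireg st' ''s'' = int d - 1 - int n * int \<Delta>)" for m st'
  let ?b = "ILess (IReg ''n'') (IReg ''k'')"
  have k: "0 < k" using v by (simp add: valid_params_def)
  have body: "0 < m \<and> runs slack_body st' (worst slack_body) (I (m - 1))"
    if H: "I m st'" "bval ?b st'" for m st'
  proof -
    have m: "0 < m" using H by (auto simp: I_def holds_params_def)
    then obtain m' where m': "m = Suc m'" by (cases m) auto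
    obtain n where n: "k = n + m + 1" "ireg st' ''n'' = int n + 1"
      "ireg st' ''s'' = int d - 1 - int n * int \<Delta>" using H by (auto simp: I_def)
    have "I m' (effect slack_body st')"
      using H(1) n m' unfolding I_def slack_body_def holds_params_def
      by (auto simp: algebra_simps intro!: exI[of _ "Suc n"])
    moreover have "loop_free slack_body" by (simp add: slack_body_def)
    ultimately show ?thesis using m' runs_effect by simp
  qed
  have init: "I (k - 1) (effect (Seq (ISet ''s'' (ISub (IReg ''d'') (IConst 1)))
      (ISet ''n'' (IConst 1))) st)"
    using h k by (auto simp: I_def holds_params_def)
  have slack: "int (slack d k \<Delta>) = int d - 1 - int (k - 1) * int \<Delta>"
    using slack_eq(2)[OF v] by (metis (no_types, lifting) add_diff_cancel_left' add_diff_cancel_right'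
        diff_diff_eq of_nat_1 of_nat_add of_nat_mult)
  show ?thesis
    unfolding slack_com_def
    apply (rule runs_mono)
      apply (rule runs_Seq[where R = "I (k - 1)"])
       apply (rule runs_effect)
        apply simp
       apply (rule init)
      apply (rule runs_While[where I = I])
       apply assumption
      apply (erule (1) body)
    using k slack apply (auto simp: I_def holds_params_def)[1]
    \<comment> \<open>Setup costs 6, each of the \<open>k - 1\<close> rounds 12 and the last test
      4.\<close>
    using k by (cases k) (auto simp: slack_body_def)
qed

section \<open>Filling the table\<close>

text \<open>Address \<open>n - 1\<close> is the left neighbour and \<open>n - k - 1\<close> the
  entry above. In row 0 the latter address is negative; the test \<open>0 < i\<close> discards the
  value read there.\<close>

definition cell_body :: com where
  "cell_body =
     Seq (RSet ''v'' (RAdd (RElem ''c'' (IReg ''p'')) (RElem ''DP'' (ISub (IReg ''n'') (IConst 1)))))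
    (Seq (RSet ''w'' (RElem ''DP'' (ISub (ISub (IReg ''n'') (IReg ''k'')) (IConst 1))))
    (Seq (If (Conj (ILess (IConst 0) (IReg ''i'')) (RLess (RReg ''v'') (RReg ''w'')))
             (RSet ''v'' (RReg ''w'')) Skip)
    (Seq (Store ''DP'' (IReg ''n'') (RReg ''v''))
    (Seq (ISet ''n'' (IAdd (IReg ''n'') (IConst 1)))
    (Seq (ISet ''j'' (IAdd (IReg ''j'') (IConst 1)))
         (ISet ''p'' (IAdd (IReg ''p'') (IReg ''Delta''))))))))"

definition row_head :: com where
  "row_head =
     Seq (Store ''DP'' (IReg ''n'') RZero)
    (Seq (ISet ''n'' (IAdd (IReg ''n'') (IConst 1)))
    (Seq (ISet ''j'' (IConst 0))
         (ISet ''p'' (IAdd (IReg ''i'') (IConst 1)))))"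

definition row_body :: com where
  "row_body =
     Seq row_head
    (Seq (While (ILess (IReg ''j'') (IReg ''k'')) cell_body)
         (ISet ''i'' (IAdd (IReg ''i'') (IConst 1))))"

text \<open>After the last row \<open>n\<close> points just past the table, so \<open>n - 1\<close>
  is the address of the entry \<open>(s, k)\<close>.\<close>

definition table_com :: com where
  "table_com =
     Seq slack_com
    (Seq (Seq (ISet ''i'' (IConst 0)) (ISet ''n'' (IConst 0)))
    (Seq (While (ILess (IReg ''i'') (IAdd (IReg ''s'') (IConst 1))) row_body)
         (RSet ''result'' (RElem ''DP'' (ISub (IReg ''n'') (IConst 1))))))"

text \<open>Register \<open>n\<close> is the address of the next table entry to be written.\<close>

definition filling :: "nat \<Rightarrow> (nat \<Rightarrow> real) \<Rightarrow> nat \<Rightarrow> nat \<Rightarrow> nat \<Rightarrow> nat \<Rightarrow> state \<Rightarrow> bool" where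
  "filling d c k \<Delta> i n st \<longleftrightarrow> holds_params d k \<Delta> st \<and> holds_vector d c st \<and>
     ireg st ''s'' = int (slack d k \<Delta>) \<and> ireg st ''i'' = int i \<and> ireg st ''n'' = int n \<and>
     (\<forall>a<n. arr st ''DP'' (int a) = best c \<Delta> (a div (k + 1)) (a mod (k + 1)))"

lemma filling_cell:
  assumes v: "valid_params d k \<Delta>"
    and f: "filling d c k \<Delta> i (i * (k + 1) + j + 1) st"
    and j: "j < k" "ireg st ''j'' = int j" and p: "ireg st ''p'' = int (1 + i + j * \<Delta>)"
    and i: "i \<le> slack d k \<Delta>"
  defines "st' \<equiv> effect cell_body st"
  shows "filling d c k \<Delta> i (i * (k + 1) + Suc j + 1) st'"
    "ireg st' ''j'' = int (Suc j)" "ireg st' ''p'' = int (1 + i + Suc j * \<Delta>)"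
proof -
  let ?n = "i * (k + 1) + j + 1"
  \<comment> \<open>Since \<open>b \<le> k\<close>, division by \<open>k + 1\<close> recovers row
    and column from the address.\<close>
  have T: "arr st ''DP'' (int (a * (k + 1) + b)) = best c \<Delta> a b"
    if "a * (k + 1) + b < ?n" "b \<le> k" for a b
  proof -
    have "(a * (k + 1) + b) div (k + 1) = a" "(a * (k + 1) + b) mod (k + 1) = b"
      using that(2) by (simp_all add: div_mult_self3 mod_mult_self3 del: mult_Suc_right)
    then show ?thesis using f that(1) unfolding filling_def by metis
  qed
  \<comment> \<open>The position must lie within \<open>{1..d}\<close>, because
    \<open>holds_vector\<close> fixes only these entries.\<close>
  have "j * \<Delta> \<le> (k - 1) * \<Delta>" using j by (intro mult_le_mono1) simp
  then have "1 + i + j * \<Delta> \<le> d" using i slack_eq(2)[OF v] by linarith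
  then have c: "arr st ''c'' (int (1 + i + j * \<Delta>)) = c (1 + i + j * \<Delta>)"
    using f by (simp add: filling_def holds_vector_def del: of_nat_add of_nat_Suc)
  have left: "arr st ''DP'' (int (i * (k + 1) + j)) = best c \<Delta> i j"
    by (rule T) (use j in auto)
  have up: "arr st ''DP'' (int ?n - int k - 1) = best c \<Delta> (i - 1) (Suc j)" if H: "0 < i"
  proof -
    obtain i' where i': "i = Suc i'" using H by (cases i) auto
    have eq: "int ?n - int k - 1 = int (i' * (k + 1) + Suc j)" by (simp add: i')
    have "arr st ''DP'' (int (i' * (k + 1) + Suc j)) = best c \<Delta> i' (Suc j)"
      by (rule T) (use i' j in auto)
    then show ?thesis unfolding eq by (simp only: i' diff_Suc_1)
  qed
  let ?v = "best c \<Delta> i (Suc j)"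
  have regs: "ireg st ''n'' = int ?n" "ireg st ''i'' = int i" "ireg st ''k'' = int k"
    "ireg st ''Delta'' = int \<Delta>"
    using f by (auto simp: filling_def holds_params_def)
  have val: "arr st' = (arr st)(''DP'' := (arr st ''DP'')(int ?n := ?v))"
  proof (cases i)
    case 0
    then show ?thesis using c left regs p by (simp add: st'_def cell_body_def add.commute)
  next
    case (Suc i')
    have l: "arr st ''DP'' (ireg st ''n'' - 1) = best c \<Delta> i j"
      using left regs by simp
    have u: "arr st ''DP'' (ireg st ''n'' - ireg st ''k'' - 1) = best c \<Delta> i' (Suc j)"
      using up regs Suc by simp
    have c': "arr st ''c'' (ireg st ''p'') = c (1 + Suc i' + j * \<Delta>)"
      using c p Suc by simp
    have "ireg st ''i'' > 0" using regs Suc by simp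
    then show ?thesis
      using regs(1) l u c' by (simp add: st'_def cell_body_def Suc max_def)
  qed
  have dm: "?n div (k + 1) = i" "?n mod (k + 1) = Suc j"
  proof -
    have "?n = i * (k + 1) + Suc j" by simp
    moreover have "Suc j < k + 1" using j by simp
    ultimately show "?n div (k + 1) = i" "?n mod (k + 1) = Suc j"
      by (metis div_mult_self3 div_less add.right_neutral add_is_0 one_neq_zero,
          metis mod_mult_self3 mod_less)
  qed
  have ir: "ireg st' = (ireg st)(''n'' := int ?n + 1, ''j'' := int j + 1,
      ''p'' := int (1 + i + j * \<Delta>) + int \<Delta>)"
    using regs j p by (auto simp: st'_def cell_body_def fun_eq_iff)
  show "ireg st' ''j'' = int (Suc j)" "ireg st' ''p'' = int (1 + i + Suc j * \<Delta>)"
    by (simp_all add: ir)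
  have "arr st' ''DP'' (int a) = best c \<Delta> (a div (k + 1)) (a mod (k + 1))"
    if "a < i * (k + 1) + Suc j + 1" for a
  proof (cases "a = ?n")
    case True
    then show ?thesis using dm by (simp add: val del: One_nat_def)
  next
    case False
    then have "a < ?n" "int a \<noteq> int ?n" using that
      by (simp, simp only: of_nat_eq_iff not_False_eq_True)
    then show ?thesis using f by (simp add: val filling_def)
  qed
  then show "filling d c k \<Delta> i (i * (k + 1) + Suc j + 1) st'"
    using f by (simp add: filling_def holds_params_def holds_vector_def ir val)
qed

lemma runs_row_body:
  assumes v: "valid_params d k \<Delta>" and f: "filling d c k \<Delta> i (i * (k + 1)) st"
    and i: "i \<le> slack d k \<Delta>"
  shows "runs row_body st (100 * k) (filling d c k \<Delta> (Suc i) (Suc i * (k + 1)))"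
proof -
  \<comment> \<open>Here \<open>j\<close> cells beyond column 0 are filled and \<open>m\<close>
    remain; \<open>p\<close> already holds the position for column \<open>j + 1\<close>.\<close>
  define I where "I m st' \<longleftrightarrow> (\<exists>j. k = j + m \<and> filling d c k \<Delta> i (i * (k + 1) + j + 1) st' \<and>
      ireg st' ''j'' = int j \<and> ireg st' ''p'' = int (1 + i + j * \<Delta>))" for m st'
  let ?b = "ILess (IReg ''j'') (IReg ''k'')"
  have k: "0 < k" using v by (simp add: valid_params_def)
  have body: "0 < m \<and> runs cell_body st' (worst cell_body) (I (m - 1))"
    if H: "I m st'" "bval ?b st'" for m st'
  proof -
    obtain j where j: "k = j + m" "filling d c k \<Delta> i (i * (k + 1) + j + 1) st'"
      "ireg st' ''j'' = int j" "ireg st' ''p'' = int (1 + i + j * \<Delta>)"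
      using H by (auto simp: I_def)
    have jk: "j < k" using H(2) j by (simp add: filling_def holds_params_def)
    then have m: "0 < m" "k = Suc j + (m - 1)" using j(1) by auto
    have "I (m - 1) (effect cell_body st')"
      unfolding I_def using filling_cell[OF v j(2) jk j(3,4) i] m(2) by blast
    moreover have "loop_free cell_body" by (simp add: cell_body_def)
    ultimately show ?thesis using m(1) runs_effect by blast
  qed
  have init: "I k (effect row_head st)"
  proof -
    define n where "n = i * (k + 1)"
    have dm: "n div (k + 1) = i" "n mod (k + 1) = 0" unfolding n_def by (simp_all del: mult_Suc_right)
    have f': "filling d c k \<Delta> i n st" using f by (simp only: n_def)
    then have val: "arr (effect row_head st) = (arr st)(''DP'' := (arr st ''DP'')(int n := 0))"
      by (simp add: row_head_def filling_def)
    have "arr (effect row_head st) ''DP'' (int a) = best c \<Delta> (a div (k + 1)) (a mod (k + 1))"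
      if "a < n + 1" for a
    proof (cases "a = n")
      case True
      then show ?thesis using dm by (simp add: val)
    next
      case False
      then show ?thesis using that f' by (simp add: val filling_def)
    qed
    moreover have "holds_params d k \<Delta> (effect row_head st)" "holds_vector d c (effect row_head st)"
      "ireg (effect row_head st) ''s'' = int (slack d k \<Delta>)"
      "ireg (effect row_head st) ''i'' = int i" "ireg (effect row_head st) ''n'' = int (n + 1)"
      "ireg (effect row_head st) ''j'' = 0" "ireg (effect row_head st) ''p'' = int (1 + i)"
      using f' by (auto simp: row_head_def filling_def holds_params_def holds_vector_def)
    ultimately show ?thesis
      unfolding I_def filling_def n_def by (intro exI[of _ 0]) simp
  qed
  have final: "filling d c k \<Delta> (Suc i) (Suc i * (k + 1))
      (effect (ISet ''i'' (IAdd (IReg ''i'') (IConst 1))) st')"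
    if H: "\<not> bval ?b st'" "\<exists>m. I m st'" for st'
  proof -
    obtain m j where j: "k = j + m" "filling d c k \<Delta> i (i * (k + 1) + j + 1) st'"
      "ireg st' ''j'' = int j" using H(2) by (auto simp: I_def)
    have "j = k" using H(1) j by (simp add: filling_def holds_params_def)
    then have "i * (k + 1) + j + 1 = Suc i * (k + 1)" by simp
    with j(2) have "filling d c k \<Delta> i (Suc i * (k + 1)) st'" by metis
    then show ?thesis by (simp add: filling_def holds_params_def holds_vector_def)
  qed
  show ?thesis
    unfolding row_body_def
    apply (rule runs_mono)
      apply (rule runs_Seq[where R = "I k"])
       apply (rule runs_effect)
        apply (simp add: row_head_def)
       apply (rule init)
      apply (rule runs_Seq)
       apply (rule runs_While[where I = I])
        apply assumption
       apply (erule (1) body)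
      apply (rule runs_effect)
       apply simp
      apply (rule final; simp)
     apply assumption
    \<comment> \<open>A cell costs at most 41 and its loop test 4; the rest of the row adds 21,
      which \<open>0 < k\<close> absorbs.\<close>
    using k by (cases k) (auto simp: cell_body_def row_head_def)
qed

lemma runs_table_com:
  assumes v: "valid_params d k \<Delta>" and h: "holds_params d k \<Delta> st" "holds_vector d c st"
  shows "runs table_com st (500 * (k * max 1 (slack d k \<Delta>)))
    (\<lambda>st'. holds_params d k \<Delta> st' \<and> holds_table d c k \<Delta> st' \<and>
       rreg st' ''result'' = best c \<Delta> (slack d k \<Delta>) k)"
proof -
  let ?s = "slack d k \<Delta>"
  define I where "I m st' \<longleftrightarrow> (\<exists>i. ?s + 1 = i + m \<and> filling d c k \<Delta> i (i * (k + 1)) st')" for m st'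
  let ?b = "ILess (IReg ''i'') (IAdd (IReg ''s'') (IConst 1))"
  let ?fin = "RSet ''result'' (RElem ''DP'' (ISub (IReg ''n'') (IConst 1)))"
  have k: "0 < k" using v by (simp add: valid_params_def)
  have body: "0 < m \<and> runs row_body st' (100 * k) (I (m - 1))"
    if H: "I m st'" "bval ?b st'" for m st'
  proof -
    obtain i where i: "?s + 1 = i + m" "filling d c k \<Delta> i (i * (k + 1)) st'"
      using H by (auto simp: I_def)
    have ile: "i \<le> ?s" using H(2) i by (simp add: filling_def)
    then have m: "0 < m" "?s + 1 = Suc i + (m - 1)" using i(1) by auto
    have "runs row_body st' (100 * k) (I (m - 1))"
      by (rule runs_mono[OF runs_row_body[OF v i(2) ile]]) (use m(2) in \<open>auto simp: I_def\<close>)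
    then show ?thesis using m(1) by simp
  qed
  have init: "I (?s + 1) (effect (Seq (ISet ''i'' (IConst 0)) (ISet ''n'' (IConst 0))) st')"
    if "holds_params d k \<Delta> st' \<and> ireg st' ''s'' = int ?s \<and> arr st' = arr st \<and> outp st' = outp st"
    for st'
    using that h(2) by (auto simp: I_def filling_def holds_params_def holds_vector_def)
  have final: "holds_params d k \<Delta> (effect ?fin st') \<and> holds_table d c k \<Delta> (effect ?fin st') \<and>
       rreg (effect ?fin st') ''result'' = best c \<Delta> ?s k"
    if H: "\<not> bval ?b st'" "\<exists>m. I m st'" for st'
  proof -
    obtain m i where i: "?s + 1 = i + m" "filling d c k \<Delta> i (i * (k + 1)) st'"
      using H(2) by (auto simp: I_def)
    have "i = ?s + 1" using H(1) i by (simp add: filling_def)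
    with i(2) have f: "filling d c k \<Delta> (?s + 1) ((?s + 1) * (k + 1)) st'" by metis
    have T: "arr st' ''DP'' (int (a * (k + 1) + b)) = best c \<Delta> a b" if "a \<le> ?s" "b \<le> k" for a b
    proof -
      have "a * (k + 1) + b < (a + 1) * (k + 1)" using that(2) by simp
      also have "\<dots> \<le> (?s + 1) * (k + 1)" using that(1) by (intro mult_le_mono1) simp
      finally have "a * (k + 1) + b < (?s + 1) * (k + 1)" .
      moreover have "(a * (k + 1) + b) div (k + 1) = a" "(a * (k + 1) + b) mod (k + 1) = b"
        using that(2) by (simp_all add: div_mult_self3 mod_mult_self3 del: mult_Suc_right)
      ultimately show ?thesis using f unfolding filling_def by metis
    qed
    have "ireg st' ''n'' - 1 = int (?s * (k + 1) + k)" using f by (simp add: filling_def)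
    then have "rreg (effect ?fin st') ''result'' = best c \<Delta> ?s k"
      using T[of ?s k] by simp
    then show ?thesis
      using f T by (simp add: holds_table_iff[OF v] filling_def holds_params_def)
  qed
  \<comment> \<open>Here \<open>a * k\<close> is the cost of the slack, \<open>b\<close> of the
    setup, \<open>e\<close> of the guard and \<open>f\<close> of the final read. Each term is at
    most a multiple of \<open>k * max 1 s\<close>; the maximum with 1 accounts for
    \<open>s = 0\<close>, where one row is still filled.\<close>
  have time: "a * k + (b + ((1 + e + 100 * k) * (?s + 1) + (1 + e) + f)) \<le> 500 * (k * max 1 ?s)"
    if "a + b + f + 3 * (1 + e) + 200 \<le> 500" for a b e f
  proof -
    let ?M = "k * max 1 ?s"
    have 1: "1 \<le> ?M" "k \<le> ?M" "max 1 ?s \<le> ?M" using k by (simp, simp, intro le_trans[OF _ mult_le_mono1[of 1 k]]) simp_all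
    have 2: "?s + 1 \<le> 2 * max 1 ?s" by simp
    have 3: "?s + 1 \<le> 2 * ?M" using 2 1(3) by linarith
    have "k * (?s + 1) \<le> 2 * ?M" using mult_le_mono2[OF 2, of k] by simp
    then have "100 * k * (?s + 1) \<le> 200 * ?M" by simp
    moreover have "(1 + e) * (?s + 1) \<le> (1 + e) * (2 * ?M)" using 3 by (rule mult_le_mono2)
    moreover have "x \<le> x * ?M" for x using mult_le_mono2[OF 1(1), of x] by simp
    then have "b \<le> b * ?M" "f \<le> f * ?M" "1 + e \<le> (1 + e) * ?M" by blast+
    moreover have "a * k \<le> a * ?M" using 1(2) by (rule mult_le_mono2)
    ultimately have "a * k + (b + ((1 + e + 100 * k) * (?s + 1) + (1 + e) + f))
        \<le> (a + b + f + 3 * (1 + e) + 200) * ?M"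
      by (simp only: add_mult_distrib add_mult_distrib2)
    also have "\<dots> \<le> 500 * ?M" using that by (rule mult_le_mono1)
    finally show ?thesis .
  qed
  show ?thesis
    unfolding table_com_def
    apply (rule runs_mono)
      apply (rule runs_Seq)
       apply (rule runs_slack_com[OF v h(1)])
      apply (rule runs_Seq[where R = "I (?s + 1)"])
       apply (rule runs_effect)
        apply simp
       apply (erule init)
      apply (rule runs_Seq)
       apply (rule runs_While[where I = I])
        apply assumption
       apply (erule (1) body)
      apply (rule runs_effect)
       apply simp
      apply (rule final; simp)
     apply assumption
    by (rule time) simp
qed

section \<open>Reading an optimal set off the table\<close>

text \<open>Adding \<open>k + 1\<close> in each of \<open>s\<close> rounds reaches the address
  \<open>s * (k + 1) + k\<close> of the entry \<open>(s, k)\<close>.\<close>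

definition address_body :: com where
  "address_body =
     Seq (ISet ''n'' (IAdd (IReg ''n'') (IAdd (IReg ''k'') (IConst 1))))
         (ISet ''i'' (IAdd (IReg ''i'') (IConst 1)))"

definition trace_init :: com where
  "trace_init = Seq (ISet ''n'' (IReg ''k'')) (ISet ''i'' (IConst 0))"

definition trace_start :: com where
  "trace_start = Seq (ISet ''j'' (IReg ''k'')) (ISet ''p'' (IReg ''d''))"

definition trace_body :: com where
  "trace_body =
     If (Conj (ILess (IConst 0) (IReg ''i''))
           (Neg (RLess (RElem ''DP'' (ISub (IReg ''n'') (IAdd (IReg ''k'') (IConst 1))))
                       (RElem ''DP'' (IReg ''n'')))))
       (Seq (ISet ''i'' (ISub (IReg ''i'') (IConst 1)))
       (Seq (ISet ''n'' (ISub (IReg ''n'') (IAdd (IReg ''k'') (IConst 1))))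
            (ISet ''p'' (ISub (IReg ''p'') (IConst 1)))))
       (Seq (Output (IReg ''p''))
       (Seq (ISet ''j'' (ISub (IReg ''j'') (IConst 1)))
       (Seq (ISet ''n'' (ISub (IReg ''n'') (IConst 1)))
            (ISet ''p'' (ISub (IReg ''p'') (IReg ''Delta''))))))"

definition trace_com :: com where
  "trace_com =
     Seq slack_com
    (Seq trace_init
    (Seq (While (ILess (IReg ''i'') (IReg ''s'')) address_body)
    (Seq trace_start
         (While (ILess (IConst 0) (IReg ''j'')) trace_body))))"

text \<open>The last conjunct says that the output so far followed by the remaining trace never
  changes. The position is an integer expression because \<open>1 + i - \<Delta>\<close> may be
  negative at \<open>j = 0\<close>.\<close>

definition tracing ::
  "nat \<Rightarrow> (nat \<Rightarrow> real) \<Rightarrow> nat \<Rightarrow> nat \<Rightarrow> int list \<Rightarrow> nat \<Rightarrow> nat \<Rightarrow> state \<Rightarrow> bool" where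
  "tracing d c k \<Delta> out i j st \<longleftrightarrow> holds_params d k \<Delta> st \<and> holds_table d c k \<Delta> st \<and>
     i \<le> slack d k \<Delta> \<and> j \<le> k \<and> ireg st ''i'' = int i \<and> ireg st ''j'' = int j \<and>
     ireg st ''n'' = int (i * (k + 1) + j) \<and>
     ireg st ''p'' = 1 + int i + int j * int \<Delta> - int \<Delta> \<and>
     outp st @ map int (trace c \<Delta> i j) = out"

text \<open>The program compares the same two entries as \<open>trace\<close>. Exactly one of
  \<open>i\<close> and \<open>j\<close> drops by one, which makes \<open>i + j\<close> the measure
  of the loop.\<close>

lemma tracing_step:
  assumes v: "valid_params d k \<Delta>" and t: "tracing d c k \<Delta> out i (Suc j) st"
  shows "tracing d c k \<Delta> out i j (effect trace_body st) \<or>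
    0 < i \<and> tracing d c k \<Delta> out (i - 1) (Suc j) (effect trace_body st)"
proof (cases i)
  case 0
  then show ?thesis
    using t by (simp add: tracing_def trace_body_def holds_params_def holds_table_def
        distrib_right)
next
  case (Suc i')
  have T: "arr st ''DP'' (int (a * (k + 1) + b)) = best c \<Delta> a b" if "a \<le> i" "b \<le> k" for a b
    using t that by (simp add: tracing_def holds_table_iff[OF v])
  have regs: "ireg st ''n'' = int (i * (k + 1) + Suc j)" "ireg st ''k'' = int k"
    "ireg st ''i'' = 1 + int i'" "Suc j \<le> k"
    using t Suc by (auto simp: tracing_def holds_params_def)
  have 1: "arr st ''DP'' (ireg st ''n'') = best c \<Delta> (Suc i') (Suc j)"
    using T[of i "Suc j"] regs Suc by simp
  have "ireg st ''n'' - (ireg st ''k'' + 1) = int (i' * (k + 1) + Suc j)"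
    using regs Suc by simp
  moreover have "arr st ''DP'' (int (i' * (k + 1) + Suc j)) = best c \<Delta> i' (Suc j)"
    by (rule T) (use regs Suc in auto)
  ultimately have 2: "arr st ''DP'' (ireg st ''n'' - (ireg st ''k'' + 1)) = best c \<Delta> i' (Suc j)"
    by (simp only:)
  show ?thesis
  proof (cases "best c \<Delta> i' (Suc j) < best c \<Delta> (Suc i') (Suc j)")
    case True
    then have "tracing d c k \<Delta> out i j (effect trace_body st)"
      using t Suc 1 2
      by (simp add: tracing_def trace_body_def holds_params_def holds_table_def
        distrib_right del: best.simps)
    then show ?thesis ..
  next
    case False
    then have "tracing d c k \<Delta> out i' (Suc j) (effect trace_body st)"
      using t Suc 1 2 regs(3)
      by (simp add: tracing_def trace_body_def holds_params_def holds_table_def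
        distrib_right del: best.simps)
    then show ?thesis using Suc by simp
  qed
qed

lemma runs_trace_com:
  assumes v: "valid_params d k \<Delta>" and h: "holds_params d k \<Delta> st" "holds_table d c k \<Delta> st"
  shows "runs trace_com st (300 * (d + k))
    (\<lambda>st'. outp st' = outp st @ map int (trace c \<Delta> (slack d k \<Delta>) k))"
proof -
  let ?s = "slack d k \<Delta>"
  define A where "A m st' \<longleftrightarrow> holds_params d k \<Delta> st' \<and> ireg st' ''s'' = int ?s \<and> arr st' = arr st \<and>
      outp st' = outp st \<and>
      (\<exists>i. ?s = i + m \<and> ireg st' ''i'' = int i \<and> ireg st' ''n'' = int (i * (k + 1) + k))" for m st'
  define I where "I m st' \<longleftrightarrow> (\<exists>i j. m = i + j \<and>
      tracing d c k \<Delta> (outp st @ map int (trace c \<Delta> ?s k)) i j st')" for m st'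
  let ?b = "ILess (IReg ''i'') (IReg ''s'')"
  let ?b' = "ILess (IConst 0) (IReg ''j'')"
  have k: "0 < k" using v by (simp add: valid_params_def)
  have A_init: "A ?s (effect trace_init st')"
    if "holds_params d k \<Delta> st' \<and> ireg st' ''s'' = int ?s \<and> arr st' = arr st \<and> outp st' = outp st"
    for st'
    using that by (auto simp: A_def trace_init_def holds_params_def)
  have A_body: "0 < m \<and> runs address_body st' (worst address_body) (A (m - 1))"
    if H: "A m st'" "bval ?b st'" for m st'
  proof -
    obtain i where i: "?s = i + m" "ireg st' ''i'' = int i" "ireg st' ''n'' = int (i * (k + 1) + k)"
      using H by (auto simp: A_def)
    have m: "0 < m" "?s = Suc i + (m - 1)" using H i by (auto simp: A_def)
    have "A (m - 1) (effect address_body st')"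
      using H(1) i m unfolding A_def address_body_def holds_params_def
      by (auto simp: distrib_right intro!: exI[of _ "Suc i"])
    moreover have "loop_free address_body" by (simp add: address_body_def)
    ultimately show ?thesis using m(1) runs_effect by blast
  qed
  have I_init: "I (?s + k) (effect trace_start st')"
    if H: "\<not> bval ?b st'" "\<exists>m. A m st'" for st'
  proof -
    obtain m i where i: "?s = i + m" "ireg st' ''i'' = int i"
      "ireg st' ''n'' = int (i * (k + 1) + k)" "A m st'"
      using H(2) by (auto simp: A_def)
    have "i = ?s" using H(1) i by (simp add: A_def)
    \<comment> \<open>The position belonging to \<open>(s, k)\<close> is \<open>d\<close>, the
      starting value of the register \<open>p\<close>.\<close>
    moreover have "int d = 1 + int ?s + int k * int \<Delta> - int \<Delta>"
    proof -
      obtain k' where "k = Suc k'" using k by (cases k) auto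
      moreover have "int d = int (1 + ?s + (k - 1) * \<Delta>)" using slack_eq(2)[OF v] by simp
      ultimately show ?thesis by (simp add: distrib_right)
    qed
    ultimately have "tracing d c k \<Delta> (outp st @ map int (trace c \<Delta> ?s k)) ?s k
        (effect trace_start st')"
      using i h(2) by (auto simp: A_def tracing_def trace_start_def holds_params_def holds_table_def)
    then show ?thesis by (auto simp: I_def)
  qed
  have I_body: "0 < m \<and> runs trace_body st' (worst trace_body) (I (m - 1))"
    if I: "I m st'" "bval ?b' st'" for m st'
  proof -
    obtain i j where t: "m = i + j"
      "tracing d c k \<Delta> (outp st @ map int (trace c \<Delta> ?s k)) i j st'"
      using I(1) by (auto simp: I_def)
    have "0 < j" using I(2) t(2) by (simp add: tracing_def)
    then obtain j' where j: "j = Suc j'" by (cases j) auto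
    have m: "0 < m" using t(1) j by simp
    have "I (m - 1) (effect trace_body st')"
      using tracing_step[OF v t(2)[unfolded j]] unfolding I_def
    proof (elim disjE conjE)
      assume "0 < i" "tracing d c k \<Delta> (outp st @ map int (trace c \<Delta> ?s k)) (i - 1) (Suc j')
        (effect trace_body st')"
      moreover have "m - 1 = (i - 1) + Suc j'" using t(1) j \<open>0 < i\<close> by simp
      ultimately show "\<exists>i j. m - 1 = i + j \<and> tracing d c k \<Delta>
        (outp st @ map int (trace c \<Delta> ?s k)) i j (effect trace_body st')" by blast
    qed (use t(1) j in auto)
    moreover have "loop_free trace_body" by (simp add: trace_body_def)
    ultimately show ?thesis using m runs_effect by blast
  qed
  \<comment> \<open>The loop ends at \<open>j = 0\<close>, possibly with slack left; the remaining
    trace is then empty.\<close>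
  have final: "outp st' = outp st @ map int (trace c \<Delta> ?s k)"
    if H: "\<not> bval ?b' st'" "\<exists>m. I m st'" for st'
    using H by (auto simp: I_def tracing_def)
  \<comment> \<open>This turns the bound linear in \<open>s + k\<close> into one linear in
    \<open>d + k\<close>.\<close>
  have "?s + 1 \<le> d" using slack_eq(2)[OF v] by linarith
  show ?thesis
    unfolding trace_com_def
    apply (rule runs_mono)
      apply (rule runs_Seq)
       apply (rule runs_slack_com[OF v h(1)])
      apply (rule runs_Seq[where R = "A ?s"])
       apply (rule runs_effect)
        apply (simp add: trace_init_def)
       apply (erule A_init)
      apply (rule runs_Seq)
       apply (rule runs_While[where I = A])
        apply assumption
       apply (erule (1) A_body)
      apply (rule runs_Seq[where R = "I (?s + k)"])
       apply (rule runs_effect)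
        apply (simp add: trace_start_def)
       apply (rule I_init; simp)
      apply (rule runs_While[where I = I])
       apply assumption
      apply (erule (1) I_body)
     apply (rule final; simp)
    using k \<open>?s + 1 \<le> d\<close>
    apply (simp add: trace_init_def trace_start_def address_body_def trace_body_def)
    done
qed

theorem theorem4:
  shows "(\<forall>d c k \<Delta>. valid_params d k \<Delta> \<longrightarrow>
            DP d c k \<Delta> (int (slack d k \<Delta>)) k = ereal (opt_value d c k \<Delta>))
       \<and> (\<exists>P C. \<forall>d c k \<Delta> st.
            valid_params d k \<Delta> \<and> holds_params d k \<Delta> st \<and> holds_vector d c st \<longrightarrow>
            (\<exists>t st'. exec P st t st' \<and> t \<le> C * (k * max 1 (slack d k \<Delta>)) \<and>
               holds_params d k \<Delta> st' \<and> holds_table d c k \<Delta> st' \<and>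
               ereal (rreg st' ''result'') = DP d c k \<Delta> (int (slack d k \<Delta>)) k))
       \<and> (\<exists>Q C. \<forall>d c k \<Delta> st.
            valid_params d k \<Delta> \<and> holds_params d k \<Delta> st \<and> holds_table d c k \<Delta> st \<longrightarrow>
            (\<exists>t st' xs S. exec Q st t st' \<and> t \<le> C * (d + k) \<and>
               outp st' = outp st @ xs \<and> distinct xs \<and> set xs = int ` S \<and>
               S \<in> sep_sets d k \<Delta> \<and> (\<Sum>i\<in>S. c i) = opt_value d c k \<Delta>))"
proof (intro conjI)
  show "\<forall>d c k \<Delta>. valid_params d k \<Delta> \<longrightarrow>
      DP d c k \<Delta> (int (slack d k \<Delta>)) k = ereal (opt_value d c k \<Delta>)"
    by (simp add: DP_eq_best best_eq_opt_value)
  show "\<exists>P C. \<forall>d c k \<Delta> st.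
      valid_params d k \<Delta> \<and> holds_params d k \<Delta> st \<and> holds_vector d c st \<longrightarrow>
      (\<exists>t st'. exec P st t st' \<and> t \<le> C * (k * max 1 (slack d k \<Delta>)) \<and>
         holds_params d k \<Delta> st' \<and> holds_table d c k \<Delta> st' \<and>
         ereal (rreg st' ''result'') = DP d c k \<Delta> (int (slack d k \<Delta>)) k)"
    \<comment> \<open>The witnesses are \<open>table_com\<close> and 500, chosen before all
      inputs.\<close>
    using runs_table_com unfolding runs_def by (metis DP_eq_best)
  show "\<exists>Q C. \<forall>d c k \<Delta> st.
      valid_params d k \<Delta> \<and> holds_params d k \<Delta> st \<and> holds_table d c k \<Delta> st \<longrightarrow>
      (\<exists>t st' xs S. exec Q st t st' \<and> t \<le> C * (d + k) \<and>
         outp st' = outp st @ xs \<and> distinct xs \<and> set xs = int ` S \<and>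
         S \<in> sep_sets d k \<Delta> \<and> (\<Sum>i\<in>S. c i) = opt_value d c k \<Delta>)"
  proof (rule exI[of _ trace_com], rule exI[of _ 300], intro allI impI, elim conjE)
    fix d c k \<Delta> st
    assume v: "valid_params d k \<Delta>" and h: "holds_params d k \<Delta> st" "holds_table d c k \<Delta> st"
    let ?xs = "trace c \<Delta> (slack d k \<Delta>) k"
    obtain t st' where "exec trace_com st t st'" "t \<le> 300 * (d + k)"
      "outp st' = outp st @ map int ?xs"
      using runs_trace_com[OF v h] unfolding runs_def by blast
    moreover have "set ?xs \<in> sep_sets d k \<Delta>" "distinct ?xs"
      "(\<Sum>i\<in>set ?xs. c i) = opt_value d c k \<Delta>"
      using trace_correct[of \<Delta> c "slack d k \<Delta>" k, unfolded slack_eq[OF v]] v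
      by (auto simp: best_eq_opt_value valid_params_def)
    moreover have "distinct (map int ?xs)" "set (map int ?xs) = int ` set ?xs"
      using \<open>distinct ?xs\<close> by (auto simp: distinct_map)
    ultimately show "\<exists>t st' xs S. exec trace_com st t st' \<and> t \<le> 300 * (d + k) \<and>
        outp st' = outp st @ xs \<and> distinct xs \<and> set xs = int ` S \<and>
        S \<in> sep_sets d k \<Delta> \<and> (\<Sum>i\<in>S. c i) = opt_value d c k \<Delta>"
      by blast
  qed
qed

end
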